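(* Let $X$ be a compact metric space with a reference Borel probability measure $\mu$, and let $\Lambda$ be a Baire space of continuous self-maps of $X$ endowed with a topology finer than the $C^0$-topology. Then for a Baire generic $f\in\Lambda$, the set $\mathcal B_{\Lambda,f}$ is equal to the set $acc(\{\hat e_n(f)\}_{n})$ of accumulation points of the sequence $\{\hat e_n(f)\}_{n\in\mathbb N}$ in $\mathcal M_1(\mathcal M_1(X))$.
   Context: $\mathcal M_1(Y)$ denotes the space of Borel probability measures on a compact metric space $Y$ with the weak-$*$ topology (compact and metrizable, e.g. by the Wasserstein metric); so $\mathcal M_1(\mathcal M_1(X))$ is a compact metrizable space. For $f:X\to X$, $e_n^f(x)=\frac1n\sum_{i=0}^{n-1}\delta_{f^i(x)}\in\mathcal M_1(X)$ and $\hat e_n(f):=(e_n^f)_*\mu\in\mathcal M_1(\mathcal M_1(X))$ is the push-forward of $\mu$ under $x\mapsto e_n^f(x)$. A map $f\in\Lambda$ statistically bifurcates toward $\hat\nu\in\mathcal M_1(\mathcal M_1(X))$ through perturbations in $\Lambda$ if there are a sequence $\{f_k\}_k$ in $\Lambda$ converging to $f$ and a sequence of natural numbers $n_k\to\infty$ such that $\hat e_{n_k}(f_k)\to\hat\nu$. $\mathcal B_{\Lambda,f}$ is the set of all such $\hat\nu$. Accumulation points of a sequence means limits of subsequences (with indices tending to infinity). Baire generic means: for all $f$ in a set containing a countable intersection of open dense subsets of $\Lambda$. *)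

theory Defs
  imports "HOL-Probability.Probability"
begin

section \<open>Borel probability measures and the weak-* topology\<close>

text \<open>
  Everything is stated for an abstract topology, so that the construction of the space of
  probability measures can be iterated.
\<close>

definition borel_of :: "'a topology \<Rightarrow> 'a measure" where
  "borel_of T = sigma (topspace T) {U. openin T U}"

definition prob_measures :: "'a topology \<Rightarrow> 'a measure set" where
  "prob_measures T = {M. sets M = sets (borel_of T) \<and> prob_space M}"

text \<open>
  The coarsest topology for which \<open>M \<mapsto> \<integral> \<phi> dM\<close> is continuous for every bounded continuous
  \<open>\<phi>\<close>. On a compact space the boundedness condition is vacuous, so there this is the topology
  induced by the duality with the space of all continuous functions.
\<close>

definition weak_star :: "'a topology \<Rightarrow> 'a measure topology" where
  "weak_star T = topology_generated_by
     {{M \<in> prob_measures T. integral\<^sup>L M \<phi> \<in> U} | \<phi> U.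
        continuous_map T euclideanreal \<phi> \<and> bounded (\<phi> ` topspace T) \<and> open U}"

lemma borel_of_euclidean: "borel_of (euclidean :: 'a::topological_space topology) = borel"
  by (simp add: borel_of_def borel_def)

lemma topspace_weak_star [simp]: "topspace (weak_star T) = prob_measures T"
proof
  show "topspace (weak_star T) \<subseteq> prob_measures T"
    by (auto simp: weak_star_def topology_generated_by_topspace)
  have "prob_measures T \<in> {{M \<in> prob_measures T. integral\<^sup>L M \<phi> \<in> U} | \<phi> U.
        continuous_map T euclideanreal \<phi> \<and> bounded (\<phi> ` topspace T) \<and> open U}"
    by (rule CollectI, rule exI[of _ "\<lambda>_. 0"], rule exI[of _ UNIV])
      (auto intro: finite_imp_bounded finite_subset[of _ "{0}"])
  then show "prob_measures T \<subseteq> topspace (weak_star T)"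
    unfolding weak_star_def topology_generated_by_topspace by blast
qed

section \<open>Empirical measures\<close>

text \<open>
  The measure \<open>(1/n) \<Sum>i<n. \<delta>\<^bsub>f\<^sup>i x\<^esub>\<close>. Only \<open>n \<ge> 1\<close> is meaningful; for \<open>n = 0\<close> this is the
  null measure.
\<close>

definition empirical :: "nat \<Rightarrow> ('a::topological_space \<Rightarrow> 'a) \<Rightarrow> 'a \<Rightarrow> 'a measure" where
  "empirical n f x =
     measure_of UNIV (sets borel) (\<lambda>A. (\<Sum>i<n. emeasure (return borel ((f ^^ i) x)) A) / of_nat n)"

definition empirical_dist ::
    "'a::topological_space measure \<Rightarrow> nat \<Rightarrow> ('a \<Rightarrow> 'a) \<Rightarrow> 'a measure measure" where
  "empirical_dist \<mu> n f = distr \<mu> (borel_of (weak_star euclidean)) (empirical n f)"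

lemma emeasure_empirical:
  assumes "A \<in> sets borel"
  shows "emeasure (empirical n f x) A =
    (\<Sum>i<n. emeasure (return borel ((f ^^ i) x)) A) / of_nat n"
proof (rule emeasure_measure_of[OF empirical_def])
  let ?m = "\<lambda>A. (\<Sum>i<n. emeasure (return borel ((f ^^ i) x)) A) / of_nat n"
  show "positive (sets (empirical n f x)) ?m"
    by (simp add: positive_def empirical_def)
  show "countably_additive (sets (empirical n f x)) ?m"
  proof (rule countably_additiveI)
    fix B :: "nat \<Rightarrow> 'a set"
    assume B: "range B \<subseteq> sets (empirical n f x)" "disjoint_family B"
    then have B': "range B \<subseteq> sets borel"
      by (simp add: empirical_def sets.sigma_sets_eq[of borel, simplified])
    have "(\<Sum>k. ?m (B k)) = (\<Sum>k. \<Sum>i<n. emeasure (return borel ((f ^^ i) x)) (B k)) / of_nat n"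
      by (simp add: divide_ennreal_def ennreal_suminf_multc)
    also have "(\<Sum>k. \<Sum>i<n. emeasure (return borel ((f ^^ i) x)) (B k)) =
        (\<Sum>i<n. \<Sum>k. emeasure (return borel ((f ^^ i) x)) (B k))"
      by (rule suminf_sum) auto
    also have "\<dots> = (\<Sum>i<n. emeasure (return borel ((f ^^ i) x)) (\<Union>k. B k))"
      using B B' by (intro sum.cong refl suminf_emeasure) auto
    finally show "(\<Sum>k. ?m (B k)) = ?m (\<Union>k. B k)" .
  qed
qed (use assms in \<open>auto simp: empirical_def sets.sigma_sets_eq[of borel, simplified]\<close>)

lemma empirical_in_prob_measures:
  assumes "n \<ge> 1"
  shows "empirical n f x \<in> prob_measures (euclidean :: 'a::topological_space topology)"
proof -
  have [simp]: "sets (empirical n f x) = sets borel" "space (empirical n f x) = UNIV"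
    by (simp_all add: empirical_def sets.sigma_sets_eq[of borel, simplified])
  have "emeasure (empirical n f x) UNIV = 1"
    using assms by (simp add: emeasure_empirical ennreal_divide_self of_nat_less_top less_imp_neq)
  then show ?thesis
    by (auto simp: prob_measures_def borel_of_euclidean intro: prob_spaceI)
qed

section \<open>Baire spaces and generic properties\<close>

definition dense_openin :: "'a topology \<Rightarrow> 'a set \<Rightarrow> bool" where
  "dense_openin T U \<longleftrightarrow> openin T U \<and> T closure_of U = topspace T"

definition baire_space :: "'a topology \<Rightarrow> bool" where
  "baire_space T \<longleftrightarrow> (\<forall>\<G>. countable \<G> \<and> (\<forall>U\<in>\<G>. dense_openin T U) \<longrightarrow>
     T closure_of (topspace T \<inter> \<Inter>\<G>) = topspace T)"

definition baire_generic :: "'a topology \<Rightarrow> ('a \<Rightarrow> bool) \<Rightarrow> bool" where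
  "baire_generic T P \<longleftrightarrow> (\<exists>\<G>. countable \<G> \<and> (\<forall>U\<in>\<G>. dense_openin T U) \<and>
     (\<forall>f \<in> topspace T \<inter> \<Inter>\<G>. P f))"

section \<open>Spaces of maps, statistical bifurcation, accumulation points\<close>

text \<open>The topology of uniform convergence on the bounded continuous self-maps.\<close>

definition C0_topology :: "('a::metric_space \<Rightarrow> 'a) topology" where
  "C0_topology = mtopology_of (cfunspace euclidean euclidean_metric)"

lemma topspace_C0_topology:
  assumes "compact (UNIV :: 'a::metric_space set)"
  shows "topspace (C0_topology :: ('a \<Rightarrow> 'a) topology) = {f. continuous_on UNIV f}"
proof -
  have eq: "Metric_space.mbounded (UNIV :: 'a set) dist S \<longleftrightarrow> bounded S" for S
    by (auto simp: Met_TC.mbounded_def bounded_def mem_cball subset_iff)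
  have "bounded (range f)" if "continuous_on UNIV f" for f :: "'a \<Rightarrow> 'a"
    using assms that compact_continuous_image compact_imp_bounded by blast
  then show ?thesis
    by (auto simp: C0_topology_def eq)
qed

text \<open>
  \<open>L\<close> is a space \<open>\<Lambda>\<close> of continuous self-maps whose topology is finer (not necessarily strictly)
  than the topology induced on \<open>\<Lambda>\<close> by uniform convergence.
\<close>

definition finer_than_C0 :: "('a::metric_space \<Rightarrow> 'a) topology \<Rightarrow> bool" where
  "finer_than_C0 L \<longleftrightarrow> (\<forall>U. openin (subtopology C0_topology (topspace L)) U \<longrightarrow> openin L U)"

text \<open>The set \<open>\<B>\<^bsub>\<Lambda>,f\<^esub>\<close>.\<close>

definition bifurcation_set ::
    "('a::topological_space \<Rightarrow> 'a) topology \<Rightarrow> 'a measure \<Rightarrow> ('a \<Rightarrow> 'a) \<Rightarrow> 'a measure measure set" where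
  "bifurcation_set L \<mu> f =
     {\<nu>. \<exists>(g :: nat \<Rightarrow> 'a \<Rightarrow> 'a) (n :: nat \<Rightarrow> nat).
        (\<forall>k. g k \<in> topspace L) \<and> limitin L g f sequentially \<and>
        filterlim n at_top sequentially \<and>
        limitin (weak_star (weak_star euclidean)) (\<lambda>k. empirical_dist \<mu> (n k) (g k)) \<nu> sequentially}"

definition accumulation_points :: "'a topology \<Rightarrow> (nat \<Rightarrow> 'a) \<Rightarrow> 'a set" where
  "accumulation_points T s = {l. \<exists>r :: nat \<Rightarrow> nat. strict_mono r \<and> limitin T (s \<circ> r) l sequentially}"

end

theory Submission
  imports Defs
begin

text \<open>
  For fixed \<open>n \<ge> 1\<close> the map \<open>f \<mapsto> e\<^sub>n(f)\<close> is continuous by dominated convergence. Given a countable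
  base of the target, for every basic \<open>V\<close> and every \<open>N\<close> the set \<open>A\<close> of all \<open>f\<close> with
  \<open>e\<^sub>n(f) \<in> V\<close> for some \<open>n > N\<close> is open, so the union of \<open>A\<close> with its exterior is open and dense.
  A map \<open>f\<close> in all these unions that is a limit of members of \<open>A\<close> lies in \<open>A\<close>, which turns
  perturbations of \<open>f\<close> into times of \<open>f\<close> itself.

  The countable base is obtained without compactness of the spaces of measures: if a topology is
  induced by countably many real functions, then nonnegative continuous functions are increasing
  limits of functions from one countable family, so by dominated convergence the integrals of that
  family induce the weak-* topology. This can be iterated.
\<close>

section \<open>Topologies induced by countably many real functions\<close>

text \<open>
  The \<open>h i\<close> need not separate points, so \<open>T\<close> may fail to be Hausdorff.
\<close>

definition countably_induced :: "'a topology \<Rightarrow> (nat \<Rightarrow> 'a \<Rightarrow> real) \<Rightarrow> bool" where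
  "countably_induced T h \<longleftrightarrow> (\<forall>i. continuous_map T euclideanreal (h i)) \<and>
     (\<forall>U x. openin T U \<and> x \<in> U \<longrightarrow>
        (\<exists>N. \<exists>\<delta>>0. {y \<in> topspace T. \<forall>i<N. \<bar>h i y - h i x\<bar> < \<delta>} \<subseteq> U))"

lemma countably_inducedD:
  assumes "countably_induced T h"
  shows "continuous_map T euclideanreal (h i)"
    and "openin T U \<Longrightarrow> x \<in> U \<Longrightarrow>
      \<exists>N. \<exists>\<delta>>0. {y \<in> topspace T. \<forall>i<N. \<bar>h i y - h i x\<bar> < \<delta>} \<subseteq> U"
  using assms unfolding countably_induced_def by blast+

section \<open>Rational coordinates and second countability\<close>

lemma rational_list_approx:
  fixes f :: "nat \<Rightarrow> real"
  assumes "\<epsilon> > 0"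
  obtains cs where "cs \<in> lists \<rat>" "length cs = N" "\<And>i. i < N \<Longrightarrow> \<bar>f i - cs ! i\<bar> < \<epsilon>"
proof -
  have "\<exists>q\<in>\<rat>. \<bar>f i - q\<bar> < \<epsilon>" for i
    using Rats_dense_in_real[of "f i" "f i + \<epsilon>"] assms by force
  then obtain c where c: "\<And>i. c i \<in> \<rat>" "\<And>i. \<bar>f i - c i\<bar> < \<epsilon>"
    by metis
  show thesis
    by (rule that[of "map c [0..<N]"]) (use c in auto)
qed

text \<open>The boxes that put finitely many coordinates \<open>h i\<close> within 1/(m+1) of
  rational numbers are indexed by a countable set, and they refine every neighbourhood.\<close>

lemma second_countable_countably_induced:
  assumes h: "countably_induced T h"
  shows "second_countable T"
proof -
  define V where "V = (\<lambda>(cs, m::nat). {y \<in> topspace T. \<forall>i<length cs. \<bar>h i y - cs ! i\<bar> < 1 / Suc m})"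
  have base: "\<exists>p \<in> lists \<rat> \<times> UNIV. x \<in> V p \<and> V p \<subseteq> U" if Ux: "openin T U" "x \<in> U" for U x
  proof -
    obtain N \<delta> where \<delta>: "\<delta> > 0" "{y \<in> topspace T. \<forall>i<N. \<bar>h i y - h i x\<bar> < \<delta>} \<subseteq> U"
      using countably_inducedD(2)[OF h Ux] by blast
    \<comment> \<open>Two points of a box of radius 1/(m+1) differ by less than 2/(m+1) in each of
      its coordinates, so the radius has to be below \<open>\<delta> / 2\<close>.\<close>
    obtain m where m: "1 / real (Suc m) < \<delta> / 2"
      by (rule nat_approx_posE[of "\<delta> / 2"]) (use \<delta>(1) in auto)
    obtain cs where cs: "cs \<in> lists \<rat>" "length cs = N" "\<And>i. i < N \<Longrightarrow> \<bar>h i x - cs ! i\<bar> < 1 / Suc m"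
      by (rule rational_list_approx[of "1 / real (Suc m)" N "\<lambda>i. h i x"]) (simp, rule that)
    have "\<bar>h i y - h i x\<bar> < \<delta>" if "\<bar>h i y - cs ! i\<bar> < 1 / Suc m" "i < N" for i y
      using cs(3)[OF that(2)] that(1) m by linarith
    then have "V (cs, m) \<subseteq> U"
      using \<delta>(2) cs(2) by (auto simp: V_def)
    moreover have "x \<in> V (cs, m)"
      using cs(2,3) openin_subset[OF Ux(1)] Ux(2) by (auto simp: V_def)
    ultimately show ?thesis
      using cs(1) by (intro bexI[of _ "(cs, m)"]) auto
  qed
  have "openin T (V p)" for p
  proof (cases p)
    case (Pair cs m)
    let ?S = "\<lambda>i. {y \<in> topspace T. \<bar>h i y - cs ! i\<bar> \<in> {..<1 / real (Suc m)}}"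
    have S: "openin T (?S i)" for i
      by (rule openin_continuous_map_preimage[where Y = euclideanreal])
        (intro continuous_intros countably_inducedD(1)[OF h], simp add: open_lessThan)
    have "openin T ((\<Inter>i\<in>{..<length cs}. ?S i) \<inter> topspace T)"
      by (rule openin_INT[OF finite_lessThan S])
    moreover have "V p = (\<Inter>i\<in>{..<length cs}. ?S i) \<inter> topspace T"
      by (auto simp: Pair V_def)
    ultimately show ?thesis by (simp only:)
  qed
  moreover have "countable (V ` (lists \<rat> \<times> UNIV))"
    by (intro countable_image countable_SIGMA countable_lists countable_rat) auto
  moreover have "\<forall>U x. openin T U \<and> x \<in> U \<longrightarrow> (\<exists>W \<in> V ` (lists \<rat> \<times> UNIV). x \<in> W \<and> W \<subseteq> U)"
    using base by (metis imageI)
  ultimately show ?thesis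
    unfolding second_countable_def by (intro exI[of _ "V ` (lists \<rat> \<times> UNIV)"] conjI ballI) auto
qed

text \<open>The coordinates are the distances to the points of a countable dense set, the union of
  finite 1/(n+1)-nets given by compactness.\<close>

lemma compact_metric_countably_induced:
  assumes "compact (UNIV :: 'a::metric_space set)"
  shows "\<exists>h. countably_induced (euclidean :: 'a topology) h"
proof -
  have "\<exists>F. finite F \<and> (\<forall>y::'a. \<exists>x\<in>F. dist x y < 1 / Suc n)" for n
  proof -
    have "\<exists>F\<subseteq>UNIV. finite F \<and> (UNIV::'a set) \<subseteq> (\<Union>x\<in>F. ball x (1 / Suc n))"
      by (rule compactE_image[OF assms, of UNIV "\<lambda>x. ball x (1 / Suc n)"]) auto
    then show ?thesis by (fastforce simp: mem_ball)
  qed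
  then obtain F where F: "\<And>n. finite (F n)" "\<And>n y::'a. \<exists>x\<in>F n. dist x y < 1 / Suc n"
    by metis
  define D where "D = (\<Union>n. F n)"
  have D: "countable D"
    unfolding D_def using F(1) by (auto intro: countable_finite)
  let ?h = "\<lambda>i y. dist (from_nat_into D i) y"
  have "\<exists>N. \<exists>\<delta>>0. {y. \<forall>i<N. \<bar>?h i y - ?h i x\<bar> < \<delta>} \<subseteq> U" if Ux: "open U" "x \<in> U" for U and x :: 'a
  proof -
    obtain r where r: "r > 0" "ball x r \<subseteq> U"
      using Ux open_contains_ball by blast
    \<comment> \<open>One coordinate suffices: if \<open>z\<close> is within r/3 of
      \<open>x\<close>, a change of less than r/3 in the distance to \<open>z\<close> leaves
      \<open>y\<close> within 2r/3 of \<open>z\<close>, hence within \<open>r\<close> of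
      \<open>x\<close>.\<close>
    obtain n where "1 / real (Suc n) < r / 3"
      by (rule nat_approx_posE[of "r / 3"]) (use r in auto)
    then obtain z where z: "z \<in> D" "dist z x < r / 3"
      using F(2)[of n x] unfolding D_def by force
    then obtain i where i: "from_nat_into D i = z"
      using from_nat_into_surj[OF D z(1)] by blast
    have "y \<in> U" if "\<bar>?h i y - ?h i x\<bar> < r / 3" for y
    proof -
      have "dist z y < 2 * r / 3"
        using that z(2) unfolding i by linarith
      then have "dist x y < r"
        using z(2) dist_triangle[of x y z] by (simp add: dist_commute)
      then show ?thesis
        using r(2) by auto
    qed
    then show ?thesis
      using r(1) by (intro exI[of _ "Suc i"] exI[of _ "r / 3"]) auto
  qed
  then have "countably_induced euclidean ?h"
    unfolding countably_induced_def by (auto intro!: continuous_intros)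
  then show ?thesis by blast
qed

text \<open>
  Every nonnegative continuous function is the pointwise supremum of the members of the family
  below it.
\<close>

definition sup_dense :: "'a topology \<Rightarrow> ('a \<Rightarrow> real) set \<Rightarrow> bool" where
  "sup_dense T G \<longleftrightarrow> (\<forall>g\<in>G. continuous_map T euclideanreal g \<and> bounded (range g) \<and> (\<forall>x. 0 \<le> g x)) \<and>
     (\<forall>\<psi> x \<epsilon>. continuous_map T euclideanreal \<psi> \<and> (\<forall>y\<in>topspace T. 0 \<le> \<psi> y) \<and> x \<in> topspace T \<and> \<epsilon> > 0 \<longrightarrow>
        (\<exists>g\<in>G. (\<forall>y\<in>topspace T. g y \<le> \<psi> y) \<and> \<psi> x - \<epsilon> < g x))"

text \<open>A narrow tent with peak slightly below \<open>\<psi> x\<close> fits under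
  \<open>\<psi>\<close>; rational heights, natural slopes and rational centres give only countably
  many tents.\<close>

lemma countably_induced_sup_dense:
  assumes h: "countably_induced T h"
  obtains G where "countable G" "sup_dense T G"
proof -
  \<comment> \<open>tents of height \<open>q\<close> and slope \<open>m\<close> around the point with coordinates \<open>cs\<close>\<close>
  let ?g = "\<lambda>q (m::nat) cs x. max 0 (q - real m * (\<Sum>i<length cs. \<bar>h i x - cs ! i\<bar>))"
  let ?G = "(\<lambda>(q, m, cs). ?g q m cs) ` (\<rat> \<times> UNIV \<times> lists \<rat>)"
  have count: "countable ?G"
    by (intro countable_image countable_SIGMA countable_lists countable_rat) auto
  have "continuous_map T euclideanreal g \<and> bounded (range g) \<and> (\<forall>x. 0 \<le> g x)" if gG: "g \<in> ?G" for g
  proof -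
    obtain q m cs where g: "g = ?g q m cs"
      using gG by auto
    have "norm (g x) \<le> max 0 q" for x
    proof -
      have "real m * (\<Sum>i<length cs. \<bar>h i x - cs ! i\<bar>) \<ge> 0"
        by (intro mult_nonneg_nonneg sum_nonneg) auto
      then show ?thesis
        unfolding g real_norm_def by linarith
    qed
    then have "bounded (range g)"
      by (intro boundedI[of _ "max 0 q"]) auto
    moreover have "continuous_map T euclideanreal g"
      unfolding g
      by (intro continuous_intros countably_inducedD(1)[OF h]) auto
    ultimately show ?thesis
      unfolding g by auto
  qed
  moreover have "\<exists>g\<in>?G. (\<forall>y\<in>topspace T. g y \<le> \<psi> y) \<and> \<psi> x - \<epsilon> < g x"
    if \<psi>: "continuous_map T euclideanreal \<psi>" "\<forall>y\<in>topspace T. 0 \<le> \<psi> y"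
      and x: "x \<in> topspace T" and \<epsilon>: "\<epsilon> > 0" for \<psi> x \<epsilon>
  proof -
    obtain q where q: "q \<in> \<rat>" "\<psi> x - 2 * \<epsilon> / 3 < q" "q < \<psi> x - \<epsilon> / 3"
      using Rats_dense_in_real[of "\<psi> x - 2 * \<epsilon> / 3" "\<psi> x - \<epsilon> / 3"] \<epsilon> by auto
    have "openin T {y \<in> topspace T. \<psi> y \<in> {q<..}}"
      by (rule openin_continuous_map_preimage[OF \<psi>(1)]) auto
    moreover have "x \<in> {y \<in> topspace T. \<psi> y \<in> {q<..}}"
      using x q \<epsilon> by auto
    ultimately obtain N \<delta> where \<delta>: "\<delta> > 0"
      "{y \<in> topspace T. \<forall>i<N. \<bar>h i y - h i x\<bar> < \<delta>} \<subseteq> {y \<in> topspace T. \<psi> y \<in> {q<..}}"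
      using countably_inducedD(2)[OF h] by meson
    \<comment> \<open>A point differing from \<open>x\<close> by at least \<open>\<delta>\<close> in
      some coordinate is at least \<open>\<delta> / 2\<close> away from the centre there, so this
      slope brings the tent down to zero.\<close>
    obtain m where m: "q * 2 / \<delta> \<le> real m"
      using real_arch_simple by blast
    \<comment> \<open>The first bound serves the points far from \<open>x\<close>. The second keeps
      the loss at \<open>x\<close> caused by the rational centre within
      \<open>\<epsilon> / 3\<close>; since \<open>q\<close> itself loses less than two thirds of
      \<open>\<epsilon>\<close>, the total stays below \<open>\<epsilon>\<close>. The successors
      avoid division by zero.\<close>
    define \<eta> where "\<eta> = min (\<delta> / 2) (\<epsilon> / 3 / (real (Suc m) * real (Suc N)))"
    have "\<eta> > 0"
      using \<delta>(1) \<epsilon> by (simp add: \<eta>_def del: of_nat_Suc)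
    obtain cs where cs: "cs \<in> lists \<rat>" "length cs = N" "\<And>i. i < N \<Longrightarrow> \<bar>h i x - cs ! i\<bar> < \<eta>"
      by (rule rational_list_approx[OF \<open>\<eta> > 0\<close>, of N "\<lambda>i. h i x"]) (rule that)
    have far: "?g q m cs y \<le> 0" if y: "i < N" "\<bar>h i y - h i x\<bar> \<ge> \<delta>" for y i
    proof -
      have "\<bar>h i y - cs ! i\<bar> \<ge> \<delta> / 2"
        using cs(3)[OF y(1)] y(2) unfolding \<eta>_def by linarith
      also have "\<bar>h i y - cs ! i\<bar> \<le> (\<Sum>i<length cs. \<bar>h i y - cs ! i\<bar>)"
        using y(1) cs(2) by (intro member_le_sum) auto
      finally have "real m * (\<delta> / 2) \<le> real m * (\<Sum>i<length cs. \<bar>h i y - cs ! i\<bar>)"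
        by (intro mult_left_mono) auto
      moreover have "q \<le> real m * (\<delta> / 2)"
        using m \<delta>(1) by (simp add: field_simps)
      ultimately show ?thesis
        by simp
    qed
    \<comment> \<open>Far from \<open>x\<close> the tent vanishes and \<open>\<psi>\<close> is
      nonnegative. Near \<open>x\<close> the tent is at most the maximum of 0 and \<open>q\<close>,
      while \<open>\<psi>\<close> exceeds \<open>q\<close>.\<close>
    have "?g q m cs y \<le> \<psi> y" if y: "y \<in> topspace T" for y
    proof (cases "\<exists>i<N. \<bar>h i y - h i x\<bar> \<ge> \<delta>")
      case True
      with far \<psi>(2) y show ?thesis by (meson order_trans)
    next
      case False
      then have "y \<in> {y \<in> topspace T. \<forall>i<N. \<bar>h i y - h i x\<bar> < \<delta>}"
        using y by (auto simp: not_le)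
      then have "\<psi> y > q"
        using \<delta>(2) by blast
      moreover have "real m * (\<Sum>i<length cs. \<bar>h i y - cs ! i\<bar>) \<ge> 0"
        by (intro mult_nonneg_nonneg sum_nonneg) auto
      ultimately show ?thesis
        using bspec[OF \<psi>(2) y] by linarith
    qed
    moreover have "\<psi> x - \<epsilon> < ?g q m cs x"
    proof -
      have "\<eta> \<le> \<epsilon> / 3 / (real (Suc m) * real (Suc N))"
        by (simp add: \<eta>_def)
      have "(\<Sum>i<length cs. \<bar>h i x - cs ! i\<bar>) \<le> (\<Sum>i<length cs. \<eta>)"
        using cs(2,3) by (intro sum_mono) (auto intro: less_imp_le)
      also have "\<dots> \<le> real (Suc N) * \<eta>"
        using \<open>\<eta> > 0\<close> cs(2) by (simp add: mult_right_mono)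
      also have "\<dots> \<le> real (Suc N) * (\<epsilon> / 3 / (real (Suc m) * real (Suc N)))"
        using \<open>\<eta> \<le> _\<close> by (intro mult_left_mono) auto
      also have "\<dots> = \<epsilon> / 3 / real (Suc m)"
        by (simp del: of_nat_Suc)
      finally have "real m * (\<Sum>i<length cs. \<bar>h i x - cs ! i\<bar>) \<le> real m * (\<epsilon> / 3 / Suc m)"
        by (intro mult_left_mono) auto
      also have "\<dots> \<le> \<epsilon> / 3"
        using \<epsilon> by (simp add: field_simps)
      finally show ?thesis
        using q by auto
    qed
    moreover have "?g q m cs \<in> ?G"
      using q(1) cs(1) by (intro image_eqI[of _ _ "(q, m, cs)"]) auto
    ultimately show ?thesis
      by (intro bexI[of _ "?g q m cs"]) (intro conjI ballI)
  qed
  ultimately have "sup_dense T ?G"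
    unfolding sup_dense_def by blast
  with count show thesis by (rule that)
qed

section \<open>Integrals of continuous functions\<close>

lemma continuous_map_measurable_borel_of:
  assumes "continuous_map S T f" "sets M = sets (borel_of S)"
  shows "f \<in> measurable M (borel_of T)"
proof -
  have M: "space M = topspace S"
    using sets_eq_imp_space_eq[OF assms(2)] by (simp add: borel_of_def space_measure_of openin_subset Pow_def Collect_mono)
  have pre: "f -` U \<inter> space M \<in> sets M" if "openin T U" for U
  proof -
    have "openin S (f -` U \<inter> topspace S)"
      using openin_continuous_map_preimage[OF assms(1) that] by (simp add: vimage_def Int_def conj_commute)
    then show ?thesis
      unfolding M assms(2) borel_of_def by (subst sets_measure_of) (auto dest: openin_subset)
  qed
  show ?thesis
    unfolding borel_of_def
    by (rule measurable_measure_of) (use pre in \<open>auto dest: openin_subset simp: M continuous_map_image_subset_topspace[OF assms(1), unfolded image_subset_iff_funcset]\<close>)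
qed

lemma prob_measuresD:
  assumes "M \<in> prob_measures T"
  shows "prob_space M" "sets M = sets (borel_of T)" "space M = topspace T"
proof -
  show "prob_space M" and *: "sets M = sets (borel_of T)"
    using assms by (auto simp: prob_measures_def)
  show "space M = topspace T"
    using sets_eq_imp_space_eq[OF *] by (simp add: borel_of_def space_measure_of openin_subset Pow_def Collect_mono)
qed

text \<open>Integrals of non-integrable functions are 0 by convention, so monotonicity and
  additivity of the integral rely on this.\<close>

lemma integrable_bounded_continuous:
  assumes "M \<in> prob_measures T" "continuous_map T euclideanreal \<phi>" "bounded (\<phi> ` topspace T)"
  shows "integrable M \<phi>"
proof -
  interpret prob_space M
    using prob_measuresD(1)[OF assms(1)] .
  obtain B where "\<forall>x\<in>topspace T. norm (\<phi> x) \<le> B"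
    using assms(3) by (auto simp: bounded_iff)
  moreover have "\<phi> \<in> borel_measurable M"
    using continuous_map_measurable_borel_of[OF assms(2) prob_measuresD(2)[OF assms(1)]]
    by (simp add: borel_of_euclidean)
  ultimately show ?thesis
    by (intro integrable_const_bound[of _ B] AE_I2) (auto simp: prob_measuresD(3)[OF assms(1)])
qed

lemma continuous_map_weak_star_integral:
  assumes "continuous_map T euclideanreal \<phi>" "bounded (\<phi> ` topspace T)"
  shows "continuous_map (weak_star T) euclideanreal (\<lambda>M. integral\<^sup>L M \<phi>)"
proof -
  have "openin (weak_star T) {M \<in> prob_measures T. integral\<^sup>L M \<phi> \<in> U}" if "open U" for U
    unfolding weak_star_def using assms that by (intro topology_generated_by_Basis) blast
  then show ?thesis
    by (auto simp: continuous_map_def)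
qed

section \<open>Finite maxima and approximation of integrals from below\<close>

primrec max_list :: "('a \<Rightarrow> real) list \<Rightarrow> 'a \<Rightarrow> real" where
  "max_list [] x = 0"
| "max_list (g # gs) x = max (g x) (max_list gs x)"

lemma max_list_nonneg: "0 \<le> max_list gs x"
  by (induction gs) (auto simp: max_def)

lemma max_list_ge: "g \<in> set gs \<Longrightarrow> g x \<le> max_list gs x"
  by (induction gs) (auto simp: max_def)

text \<open>The empty list has maximum 0, hence the condition on \<open>c\<close>; for nonnegative
  functions this default does not alter the maximum.\<close>

lemma max_list_le: "(\<And>g. g \<in> set gs \<Longrightarrow> g x \<le> c) \<Longrightarrow> 0 \<le> c \<Longrightarrow> max_list gs x \<le> c"
  by (induction gs) auto

lemma continuous_map_max_list:
  assumes "\<And>g. g \<in> set gs \<Longrightarrow> continuous_map T euclideanreal g"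
  shows "continuous_map T euclideanreal (max_list gs)"
  using assms
proof (induction gs)
  case Nil
  then show ?case by simp
next
  case (Cons g gs)
  then have "continuous_map T euclideanreal (\<lambda>x. max (g x) (max_list gs x))"
    by (intro continuous_intros) auto
  then show ?case by simp
qed

lemma bounded_max_list:
  assumes "\<And>g. g \<in> set gs \<Longrightarrow> bounded (range g)"
  shows "bounded (range (max_list gs))"
proof -
  have "\<exists>B\<ge>0. \<forall>x. max_list gs x \<le> B"
    using assms
  proof (induction gs)
    case Nil
    then show ?case by auto
  next
    case (Cons g gs)
    then obtain B where B: "B \<ge> 0" "\<forall>x. max_list gs x \<le> B"
      by auto
    obtain C where C: "\<forall>x. \<bar>g x\<bar> \<le> C"
      using Cons.prems[of g] by (auto simp: bounded_iff)
    then have "max_list (g # gs) x \<le> max B C" for x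
      using B(2)[rule_format, of x] C[rule_format, of x] unfolding max_list.simps by linarith
    with B(1) show ?case
      by (intro exI[of _ "max B C"]) auto
  qed
  then show ?thesis
    using max_list_nonneg[of gs] by (auto simp: bounded_iff)
qed

text \<open>Sup-density gives closeness to \<open>\<psi>\<close> at one point only. Enumerating the
  members of \<open>G\<close> below \<open>\<psi>\<close> and taking maxima of the first
  \<open>k\<close> gives pointwise convergence, with values between 0 and a bound of
  \<open>\<psi>\<close>, so dominated convergence applies.\<close>

lemma sup_dense_integral_approx:
  assumes G: "countable G" "sup_dense T G"
    and M: "M \<in> prob_measures T"
    and \<psi>: "continuous_map T euclideanreal \<psi>" "bounded (\<psi> ` topspace T)" "\<And>y. y \<in> topspace T \<Longrightarrow> 0 \<le> \<psi> y"
    and "\<epsilon> > 0"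
  obtains gs where "gs \<in> lists G" "\<And>y. y \<in> topspace T \<Longrightarrow> max_list gs y \<le> \<psi> y"
    "integral\<^sup>L M \<psi> - \<epsilon> < integral\<^sup>L M (max_list gs)"
proof -
  interpret prob_space M
    using prob_measuresD(1)[OF M] .
  have sp: "space M = topspace T"
    by (rule prob_measuresD(3)[OF M])
  define D where "D = {g \<in> G. \<forall>y\<in>topspace T. g y \<le> \<psi> y}"
  have D: "\<exists>g\<in>D. \<psi> x - e < g x" if "x \<in> topspace T" "e > 0" for x e
  proof -
    have "\<exists>g\<in>G. (\<forall>y\<in>topspace T. g y \<le> \<psi> y) \<and> \<psi> x - e < g x"
      using G(2) \<psi>(1,3) that unfolding sup_dense_def by blast
    then show ?thesis
      by (auto simp: D_def)
  qed
  \<comment> \<open>\<open>from_nat_into D\<close> takes its values in \<open>D\<close> only if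
    \<open>D\<close> is nonempty; the space of a probability measure has a point, at which the
    approximation property yields a member.\<close>
  obtain x0 where "x0 \<in> topspace T"
    using not_empty unfolding sp by blast
  then have "D \<noteq> {}"
    using D[of x0 1] by auto
  have "countable D"
    using G(1) by (auto simp: D_def intro: countable_subset)
  define H where "H k = map (from_nat_into D) [0..<k]" for k
  have HD: "set (H k) \<subseteq> D" for k
    using from_nat_into[OF \<open>D \<noteq> {}\<close>] by (auto simp: H_def)
  have HG: "H k \<in> lists G" for k
    using HD[of k] by (auto simp: D_def)
  have le: "max_list (H k) y \<le> \<psi> y" if "y \<in> topspace T" for y k
    using HD[of k] that \<psi>(3) by (intro max_list_le) (auto simp: D_def)
  have Gc: "continuous_map T euclideanreal g" "bounded (range g)" if "g \<in> G" for g
    using G(2) that unfolding sup_dense_def by blast+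
  obtain B where B: "\<forall>x\<in>topspace T. norm (\<psi> x) \<le> B"
    using \<psi>(2) by (auto simp: bounded_iff)
  have meas: "\<phi> \<in> borel_measurable M" if "continuous_map T euclideanreal \<phi>" for \<phi> :: "'a \<Rightarrow> real"
    using continuous_map_measurable_borel_of[OF that prob_measuresD(2)[OF M]]
    by (simp add: borel_of_euclidean)
  have "(\<lambda>k. max_list (H k) x) \<longlonglongrightarrow> \<psi> x" if x: "x \<in> topspace T" for x
  proof (rule LIMSEQ_I)
    fix e :: real assume "0 < e"
    then obtain g where g: "g \<in> D" "\<psi> x - e < g x"
      using D[OF x] by blast
    obtain n where n: "from_nat_into D n = g"
      using from_nat_into_surj[OF \<open>countable D\<close> g(1)] by blast
    \<comment> \<open>\<open>H k\<close> lists the indices below \<open>k\<close>, so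
      \<open>g\<close>, of index \<open>n\<close>, occurs from \<open>Suc n\<close> on.\<close>
    have "norm (max_list (H k) x - \<psi> x) < e" if "k \<ge> Suc n" for k
    proof -
      have "g \<in> set (H k)"
        using that n by (auto simp: H_def)
      then have "g x \<le> max_list (H k) x"
        by (rule max_list_ge)
      with g(2) le[OF x, of k] show ?thesis
        unfolding real_norm_def by linarith
    qed
    then show "\<exists>no. \<forall>k\<ge>no. norm (max_list (H k) x - \<psi> x) < e"
      by blast
  qed
  moreover have "norm (max_list (H k) x) \<le> B" if "x \<in> topspace T" for x k
    using le[OF that, of k] max_list_nonneg[of "H k" x] bspec[OF B that] unfolding real_norm_def by linarith
  moreover have "max_list (H k) \<in> borel_measurable M" for k
    using HG[of k] Gc(1) by (intro meas continuous_map_max_list) auto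
  ultimately have "(\<lambda>k. integral\<^sup>L M (max_list (H k))) \<longlonglongrightarrow> integral\<^sup>L M \<psi>"
    using meas[OF \<psi>(1)]
    by (intro integral_dominated_convergence[where w = "\<lambda>_. B"] AE_I2) (auto simp: sp)
  then have "\<forall>\<^sub>F k in sequentially. integral\<^sup>L M \<psi> - \<epsilon> < integral\<^sup>L M (max_list (H k))"
    using \<open>\<epsilon> > 0\<close> by (intro order_tendstoD(1)) auto
  then obtain k where "integral\<^sup>L M \<psi> - \<epsilon> < integral\<^sup>L M (max_list (H k))"
    by (auto simp: eventually_sequentially)
  then show thesis
    using that[of "H k"] HG le by blast
qed

text \<open>The new coordinates are the integrals of finite maxima from a countable sup-dense
  family. As integrals of bounded continuous functions they are continuous; the work is to show that
  they detect every subbasic neighbourhood.\<close>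

lemma countably_induced_weak_star:
  assumes "countably_induced T h"
  obtains h' where "countably_induced (weak_star T) h'"
proof -
  obtain G where G: "countable G" "sup_dense T G"
    by (rule countably_induced_sup_dense[OF assms])
  have G': "continuous_map T euclideanreal g" "bounded (range g)" if "g \<in> G" for g
    using G(2) that unfolding sup_dense_def by blast+
  let ?W = "weak_star T"
  define gs where "gs = from_nat_into (lists G)"
  define h' where "h' i M = integral\<^sup>L M (max_list (gs i))" for i M
  have gsG: "gs i \<in> lists G" for i
    unfolding gs_def by (rule from_nat_into) auto
  have H: "continuous_map T euclideanreal (max_list (gs i))" "bounded (max_list (gs i) ` topspace T)" for i
  proof -
    have *: "g \<in> G" if "g \<in> set (gs i)" for g
      using that gsG[of i] by auto
    show "continuous_map T euclideanreal (max_list (gs i))"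
      by (intro continuous_map_max_list G' *)
    have "bounded (range (max_list (gs i)))"
      by (intro bounded_max_list G' *)
    then show "bounded (max_list (gs i) ` topspace T)"
      by (rule bounded_subset) auto
  qed
  \<comment> \<open>Adding a constant makes \<open>\<psi>\<close> nonnegative, so its integral is a supremum of members of the
    countable family. This gives lower semicontinuity; upper semicontinuity is the same for \<open>-\<psi>\<close>.\<close>
  have lower: "\<exists>i. \<exists>\<delta>>0. \<forall>M'\<in>prob_measures T. \<bar>h' i M' - h' i M\<bar> < \<delta> \<longrightarrow> integral\<^sup>L M \<psi> - \<epsilon> < integral\<^sup>L M' \<psi>"
    if M: "M \<in> prob_measures T"
      and \<psi>: "continuous_map T euclideanreal \<psi>" "bounded (\<psi> ` topspace T)" and \<epsilon>: "\<epsilon> > 0" for M \<psi> \<epsilon>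
  proof -
    obtain B where B: "\<forall>x\<in>topspace T. norm (\<psi> x) \<le> B"
      using \<psi>(2) by (auto simp: bounded_iff)
    have shift: "continuous_map T euclideanreal (\<lambda>x. \<psi> x + B)" "bounded ((\<lambda>x. \<psi> x + B) ` topspace T)"
    proof -
      show "continuous_map T euclideanreal (\<lambda>x. \<psi> x + B)"
        by (intro continuous_intros \<psi>(1)) auto
      show "bounded ((\<lambda>x. \<psi> x + B) ` topspace T)"
        using bounded_plus_comp[OF \<psi>(2), of "\<lambda>_. B"] by (auto simp: image_constant_conv)
    qed
    have shift_int: "(\<integral>x. \<psi> x + B \<partial>N) = integral\<^sup>L N \<psi> + B" if N: "N \<in> prob_measures T" for N
    proof -
      interpret prob_space N
        by (rule prob_measuresD(1)[OF N])
      show ?thesis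
        using integrable_bounded_continuous[OF N \<psi>] by (simp add: prob_space)
    qed
    have nonneg: "0 \<le> \<psi> y + B" if "y \<in> topspace T" for y
      using bspec[OF B that] unfolding real_norm_def by linarith
    obtain l where l: "l \<in> lists G" "\<And>y. y \<in> topspace T \<Longrightarrow> max_list l y \<le> \<psi> y + B"
      "(\<integral>x. \<psi> x + B \<partial>M) - \<epsilon> / 2 < integral\<^sup>L M (max_list l)"
      by (rule sup_dense_integral_approx[OF G M shift nonneg, of "\<epsilon> / 2"]) (use \<epsilon> in auto)
    have "countable (lists G)"
      using G(1) by blast
    then obtain i where i: "gs i = l"
      unfolding gs_def using from_nat_into_surj[OF _ l(1)] by blast
    \<comment> \<open>Half of \<open>\<epsilon>\<close> is lost in replacing
      \<open>\<psi> + B\<close> by \<open>max_list l\<close> at \<open>M\<close>, the other half in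
      passing from \<open>M\<close> to \<open>M'\<close>; there \<open>max_list l\<close> is again
      at most \<open>\<psi> + B\<close>, and \<open>B\<close> cancels.\<close>
    have "integral\<^sup>L M \<psi> - \<epsilon> < integral\<^sup>L M' \<psi>"
      if M': "M' \<in> prob_measures T" "\<bar>h' i M' - h' i M\<bar> < \<epsilon> / 2" for M'
    proof -
      have "h' i M' \<le> (\<integral>x. \<psi> x + B \<partial>M')"
        unfolding h'_def
        by (intro integral_mono integrable_bounded_continuous[OF M'(1)] H shift)
          (use l(2) i prob_measuresD(3)[OF M'(1)] in auto)
      with M'(2) l(3) show ?thesis
        unfolding shift_int[OF M] shift_int[OF M'(1)] h'_def i by linarith
    qed
    then show ?thesis
      using \<epsilon> by (intro exI[of _ i] exI[of _ "\<epsilon> / 2"]) auto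
  qed
  \<comment> \<open>The property survives intersections (larger \<open>N\<close>, smaller
    \<open>\<delta>\<close>) and unions, so induction leaves the subbasic sets. There one coordinate
    controls the integral from below and another from above.\<close>
  have nbhd: "\<exists>N. \<exists>\<delta>>0. {M' \<in> prob_measures T. \<forall>i<N. \<bar>h' i M' - h' i M\<bar> < \<delta>} \<subseteq> U"
    if "generate_topology_on {{M \<in> prob_measures T. integral\<^sup>L M \<phi> \<in> U} | \<phi> U.
        continuous_map T euclideanreal \<phi> \<and> bounded (\<phi> ` topspace T) \<and> open U} U" "M \<in> U" for U M
    using that
  proof (induction U arbitrary: M rule: generate_topology_on.induct)
    case Empty
    then show ?case by simp
  next
    case (Int a b)
    obtain N1 d1 where 1: "d1 > 0" "{M' \<in> prob_measures T. \<forall>i<N1. \<bar>h' i M' - h' i M\<bar> < d1} \<subseteq> a"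
      using Int.IH(1)[of M] Int.prems by blast
    obtain N2 d2 where 2: "d2 > 0" "{M' \<in> prob_measures T. \<forall>i<N2. \<bar>h' i M' - h' i M\<bar> < d2} \<subseteq> b"
      using Int.IH(2)[of M] Int.prems by blast
    have "{M' \<in> prob_measures T. \<forall>i<max N1 N2. \<bar>h' i M' - h' i M\<bar> < min d1 d2} \<subseteq> a \<inter> b"
      using 1(2) 2(2) by fastforce
    then show ?case
      using 1(1) 2(1) by (intro exI[of _ "max N1 N2"] exI[of _ "min d1 d2"]) auto
  next
    case (UN K)
    then obtain k where "k \<in> K" "M \<in> k"
      by blast
    with UN.IH[of k M] show ?case
      by (meson Union_upper subset_trans)
  next
    case (Basis s)
    then obtain \<phi> U where s: "s = {M \<in> prob_measures T. integral\<^sup>L M \<phi> \<in> U}"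
      and \<phi>: "continuous_map T euclideanreal \<phi>" "bounded (\<phi> ` topspace T)" and "open U"
      by blast
    have M: "M \<in> prob_measures T" "integral\<^sup>L M \<phi> \<in> U"
      using Basis.prems s by auto
    obtain e where e: "e > 0" "ball (integral\<^sup>L M \<phi>) e \<subseteq> U"
      using \<open>open U\<close> M(2) open_contains_ball by blast
    obtain i d1 where 1: "d1 > 0" "\<forall>M'\<in>prob_measures T. \<bar>h' i M' - h' i M\<bar> < d1 \<longrightarrow> integral\<^sup>L M \<phi> - e < integral\<^sup>L M' \<phi>"
      using lower[OF M(1) \<phi> e(1)] by blast
    have neg: "continuous_map T euclideanreal (\<lambda>x. - \<phi> x)" "bounded ((\<lambda>x. - \<phi> x) ` topspace T)"
    proof -
      show "continuous_map T euclideanreal (\<lambda>x. - \<phi> x)"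
        by (intro continuous_intros \<phi>(1))
      show "bounded ((\<lambda>x. - \<phi> x) ` topspace T)"
        using \<phi>(2) by (simp add: bounded_iff)
    qed
    obtain j d2 where 2: "d2 > 0"
      "\<forall>M'\<in>prob_measures T. \<bar>h' j M' - h' j M\<bar> < d2 \<longrightarrow> (\<integral>x. - \<phi> x \<partial>M) - e < (\<integral>x. - \<phi> x \<partial>M')"
      using lower[OF M(1) neg e(1)] by blast
    have "M' \<in> s" if M': "M' \<in> prob_measures T" "\<forall>k<Suc (max i j). \<bar>h' k M' - h' k M\<bar> < min d1 d2" for M'
    proof -
      have "integral\<^sup>L M \<phi> - e < integral\<^sup>L M' \<phi>"
        using 1(2) M' by (simp add: less_Suc_eq_le)
      moreover have "integral\<^sup>L M' \<phi> < integral\<^sup>L M \<phi> + e"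
        using 2(2)[rule_format, of M'] M' by (simp add: less_Suc_eq_le)
      ultimately have "integral\<^sup>L M' \<phi> \<in> ball (integral\<^sup>L M \<phi>) e"
        by (simp add: dist_real_def abs_less_iff)
      then show ?thesis
        using e(2) M'(1) s by blast
    qed
    then show ?case
      using 1(1) 2(1) by (intro exI[of _ "Suc (max i j)"] exI[of _ "min d1 d2"]) auto
  qed
  have "continuous_map ?W euclideanreal (h' i)" for i
    unfolding h'_def by (intro continuous_map_weak_star_integral H)
  moreover have "\<forall>U M. openin ?W U \<and> M \<in> U \<longrightarrow>
    (\<exists>N. \<exists>\<delta>>0. {M' \<in> topspace ?W. \<forall>i<N. \<bar>h' i M' - h' i M\<bar> < \<delta>} \<subseteq> U)"
    using nbhd unfolding topspace_weak_star by (simp add: weak_star_def openin_topology_generated_by_iff)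
  ultimately have "countably_induced ?W h'"
    unfolding countably_induced_def by blast
  then show thesis by (rule that)
qed

section \<open>A countable base for the measures on the space of measures\<close>

lemma second_countable_weak_star_weak_star:
  assumes "compact (UNIV :: 'a::metric_space set)"
  shows "second_countable (weak_star (weak_star (euclidean :: 'a topology)))"
proof -
  obtain h where "countably_induced (euclidean :: 'a topology) h"
    using compact_metric_countably_induced[OF assms] by blast
  then obtain h' where "countably_induced (weak_star (euclidean :: 'a topology)) h'"
    by (rule countably_induced_weak_star)
  then obtain h'' where "countably_induced (weak_star (weak_star (euclidean :: 'a topology))) h''"
    by (rule countably_induced_weak_star)
  then show ?thesis
    by (rule second_countable_countably_induced)
qed

section \<open>Continuity of empirical distributions\<close>

text \<open>Writing the empirical measure as a push-forward of the uniform distribution on the times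
  below \<open>n\<close> turns integrals against it into finite averages.\<close>

lemma empirical_eq_distr:
  assumes "n \<ge> 1"
  shows "empirical n f x = distr (measure_pmf (pmf_of_set {..<n})) borel (\<lambda>i. (f ^^ i) x)"
proof (rule measure_eqI)
  have sets: "sets (empirical n f x) = sets borel"
    by (simp add: empirical_def sets.sigma_sets_eq[of borel, simplified])
  then show "sets (empirical n f x) = sets (distr (measure_pmf (pmf_of_set {..<n})) borel (\<lambda>i. (f ^^ i) x))"
    by simp
  fix A assume "A \<in> sets (empirical n f x)"
  then have A: "A \<in> sets borel"
    by (simp add: sets)
  have ne: "{..<n} \<noteq> {}"
    using assms by (auto simp: lessThan_empty_iff)
  have "emeasure (distr (measure_pmf (pmf_of_set {..<n})) borel (\<lambda>i. (f ^^ i) x)) A =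
      (\<integral>\<^sup>+ i. indicator ((\<lambda>i. (f ^^ i) x) -` A) i \<partial>measure_pmf (pmf_of_set {..<n}))"
    using A by (simp add: emeasure_distr)
  also have "\<dots> = (\<integral>\<^sup>+ i. indicator A ((f ^^ i) x) \<partial>measure_pmf (pmf_of_set {..<n}))"
    by (intro nn_integral_cong) (simp add: indicator_def)
  also have "\<dots> = (\<Sum>i<n. indicator A ((f ^^ i) x)) / of_nat n"
    using ne by (simp add: nn_integral_pmf_of_set)
  also have "\<dots> = emeasure (empirical n f x) A"
    using A by (simp add: emeasure_empirical)
  finally show "emeasure (empirical n f x) A = emeasure (distr (measure_pmf (pmf_of_set {..<n})) borel (\<lambda>i. (f ^^ i) x)) A"
    by simp
qed

lemma integral_empirical:
  fixes \<phi> :: "'a::topological_space \<Rightarrow> real"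
  assumes "n \<ge> 1" "\<phi> \<in> borel_measurable borel"
  shows "integral\<^sup>L (empirical n f x) \<phi> = (\<Sum>i<n. \<phi> ((f ^^ i) x)) / real n"
proof -
  have "{..<n} \<noteq> {}"
    using assms(1) by (auto simp: lessThan_empty_iff)
  then show ?thesis
    using assms by (simp add: empirical_eq_distr integral_distr integral_pmf_of_set)
qed

text \<open>Integrals of \<open>\<phi>\<close> are averages of \<open>\<phi>\<close> along the
  orbit, so continuity of each orbit point suffices. Map and starting point both depend on
  \<open>z\<close>: varying the point gives measurability, varying the map gives continuity in
  \<open>f\<close>.\<close>

lemma continuous_map_empirical:
  fixes F :: "'b \<Rightarrow> 'a::topological_space \<Rightarrow> 'a" and p :: "'b \<Rightarrow> 'a"
  assumes "n \<ge> 1" "\<And>i. continuous_map Z euclidean (\<lambda>z. (F z ^^ i) (p z))"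
  shows "continuous_map Z (weak_star euclidean) (\<lambda>z. empirical n (F z) (p z))"
  unfolding weak_star_def
proof (rule continuous_on_generated_topo)
  let ?e = "\<lambda>z. empirical n (F z) (p z)"
  have P: "?e z \<in> prob_measures euclidean" for z
    by (rule empirical_in_prob_measures[OF assms(1)])
  show "?e ` topspace Z \<subseteq> \<Union> {{M \<in> prob_measures euclidean. integral\<^sup>L M \<phi> \<in> U} | \<phi> U.
        continuous_map euclidean euclideanreal \<phi> \<and> bounded (\<phi> ` topspace euclidean) \<and> open U}"
    using P topspace_weak_star[of "euclidean :: 'a topology", unfolded weak_star_def topology_generated_by_topspace]
    by blast
  fix V assume "V \<in> {{M \<in> prob_measures (euclidean :: 'a topology). integral\<^sup>L M \<phi> \<in> U} | \<phi> U.
        continuous_map euclidean euclideanreal \<phi> \<and> bounded (\<phi> ` topspace euclidean) \<and> open U}"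
  then obtain \<phi> :: "'a \<Rightarrow> real" and U where V: "V = {M \<in> prob_measures euclidean. integral\<^sup>L M \<phi> \<in> U}"
    and \<phi>: "continuous_map euclidean euclideanreal \<phi>" and "open U"
    by blast
  have "continuous_map Z euclideanreal (\<lambda>z. (\<Sum>i<n. \<phi> ((F z ^^ i) (p z))) / real n)"
    by (intro continuous_intros continuous_map_compose[OF assms(2) \<phi>, unfolded o_def])
       (use assms(1) in auto)
  then have "openin Z {z \<in> topspace Z. (\<Sum>i<n. \<phi> ((F z ^^ i) (p z))) / real n \<in> U}"
    by (rule openin_continuous_map_preimage) (use \<open>open U\<close> in auto)
  moreover have "\<phi> \<in> borel_measurable borel"
    using \<phi> by (simp add: borel_measurable_continuous_onI)
  then have "?e -` V \<inter> topspace Z = {z \<in> topspace Z. (\<Sum>i<n. \<phi> ((F z ^^ i) (p z))) / real n \<in> U}"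
    using P by (auto simp: V integral_empirical[OF assms(1)])
  ultimately show "openin Z (?e -` V \<inter> topspace Z)"
    by simp
qed

section \<open>Sequential continuity and the topology of uniform convergence\<close>

lemma (in Metric_space) continuous_map_if_sequentially:
  fixes f :: "'a \<Rightarrow> 'b::topological_space"
  assumes "\<And>\<sigma> l. range \<sigma> \<subseteq> M \<Longrightarrow> limitin mtopology \<sigma> l sequentially \<Longrightarrow> (\<lambda>k. f (\<sigma> k)) \<longlonglongrightarrow> f l"
  shows "continuous_map mtopology euclidean f"
  unfolding continuous_map_closedin
proof (intro conjI ballI allI impI)
  fix C :: "'b set" assume "closedin euclidean C"
  then have "closed C"
    by simp
  show "closedin mtopology {x \<in> topspace mtopology. f x \<in> C}"
    unfolding metric_closedin_iff_sequentially_closed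
  proof (intro conjI allI impI)
    fix \<sigma> l
    assume *: "range \<sigma> \<subseteq> {x \<in> topspace mtopology. f x \<in> C} \<and> limitin mtopology \<sigma> l sequentially"
    then have "(\<lambda>k. f (\<sigma> k)) \<longlonglongrightarrow> f l"
      by (intro assms) auto
    moreover have "f (\<sigma> k) \<in> C" for k
      using * by auto
    ultimately have "f l \<in> C"
      by (rule Lim_in_closed_set[OF \<open>closed C\<close> always_eventually[OF allI] sequentially_bot, rotated])
    with limitin_topspace[OF conjunct2[OF *]] show "l \<in> {x \<in> topspace mtopology. f x \<in> C}"
      by simp
  qed auto
qed auto

text \<open>Dominated convergence speaks about sequences; as the topology comes from a metric,
  testing continuity along sequences is enough.\<close>

lemma C0_topology_continuous_map_if_sequentially:
  fixes f :: "('a::metric_space \<Rightarrow> 'a) \<Rightarrow> 'b::topological_space"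
  assumes "\<And>\<sigma> l. range \<sigma> \<subseteq> topspace C0_topology \<Longrightarrow> limitin C0_topology \<sigma> l sequentially \<Longrightarrow> (\<lambda>k. f (\<sigma> k)) \<longlonglongrightarrow> f l"
  shows "continuous_map C0_topology euclidean f"
proof -
  let ?m = "cfunspace (euclidean :: 'a topology) (euclidean_metric :: 'a metric)"
  interpret F: Metric_space "mspace ?m" "mdist ?m"
    by (rule Metric_space_mspace_mdist)
  have eq: "C0_topology = F.mtopology"
    by (simp only: C0_topology_def mtopology_of_def)
  show ?thesis
    unfolding eq
    by (rule F.continuous_map_if_sequentially, rule assms) (simp_all only: eq F.topspace_mtopology)
qed

text \<open>By induction on \<open>i\<close>: the error splits into the distance of
  \<open>\<sigma> k\<close> and \<open>l\<close> at a point that moves with \<open>k\<close>, which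
  uniform convergence controls, and the continuity of \<open>l\<close> along the previous orbit
  points.\<close>

lemma C0_limit_funpow:
  fixes \<sigma> :: "nat \<Rightarrow> 'a::metric_space \<Rightarrow> 'a"
  assumes lim: "limitin C0_topology \<sigma> l sequentially"
  shows "(\<lambda>k. (\<sigma> k ^^ i) x) \<longlonglongrightarrow> (l ^^ i) x"
proof (induction i)
  case 0
  then show ?case by simp
next
  case (Suc i)
  let ?m = "cfunspace (euclidean :: 'a topology) (euclidean_metric :: 'a metric)"
  interpret F: Metric_space "mspace ?m" "mdist ?m"
    by (rule Metric_space_mspace_mdist)
  have L: "l \<in> mspace ?m" "\<And>\<epsilon>. \<epsilon> > 0 \<Longrightarrow> \<exists>N. \<forall>k\<ge>N. \<sigma> k \<in> mspace ?m \<and> mdist ?m (\<sigma> k) l < \<epsilon>"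
    using lim unfolding C0_topology_def mtopology_of_def F.limit_metric_sequentially by blast+
  have l: "continuous_on UNIV l"
    using L(1) by simp
  have 1: "(\<lambda>k. l ((\<sigma> k ^^ i) x)) \<longlonglongrightarrow> l ((l ^^ i) x)"
    by (rule continuous_on_tendsto_compose[OF l Suc]) simp_all
  have 2: "(\<lambda>k. dist (\<sigma> k ((\<sigma> k ^^ i) x)) (l ((\<sigma> k ^^ i) x))) \<longlonglongrightarrow> 0"
  proof (rule LIMSEQ_I)
    fix e :: real assume "e > 0"
    then obtain N where N: "\<And>k. k \<ge> N \<Longrightarrow> \<sigma> k \<in> mspace ?m \<and> mdist ?m (\<sigma> k) l < e / 2"
      using L(2)[of "e / 2"] by auto
    have le: "dist (\<sigma> k y) (l y) \<le> e / 2" if "k \<ge> N" for k y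
      using mdist_cfunspace_imp_mdist_le[of "\<sigma> k" euclidean euclidean_metric l "e / 2" y] N[OF that] L(1)
      by (auto simp del: mspace_cfunspace)
    have "norm (dist (\<sigma> k ((\<sigma> k ^^ i) x)) (l ((\<sigma> k ^^ i) x)) - 0) < e" if "k \<ge> N" for k
      using le[OF that, of "(\<sigma> k ^^ i) x"] \<open>e > 0\<close> by simp
    then show "\<exists>N. \<forall>k\<ge>N. norm (dist (\<sigma> k ((\<sigma> k ^^ i) x)) (l ((\<sigma> k ^^ i) x)) - 0) < e"
      by blast
  qed
  have "(\<lambda>k. dist (\<sigma> k ((\<sigma> k ^^ i) x)) (l ((l ^^ i) x))) \<longlonglongrightarrow> 0"
  proof (rule tendsto_sandwich[OF _ _ tendsto_const])
    show "\<forall>\<^sub>F k in sequentially. 0 \<le> dist (\<sigma> k ((\<sigma> k ^^ i) x)) (l ((l ^^ i) x))"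
      by simp
    show "\<forall>\<^sub>F k in sequentially. dist (\<sigma> k ((\<sigma> k ^^ i) x)) (l ((l ^^ i) x)) \<le>
        dist (\<sigma> k ((\<sigma> k ^^ i) x)) (l ((\<sigma> k ^^ i) x)) + dist (l ((\<sigma> k ^^ i) x)) (l ((l ^^ i) x))"
      by (simp add: dist_triangle)
    show "(\<lambda>k. dist (\<sigma> k ((\<sigma> k ^^ i) x)) (l ((\<sigma> k ^^ i) x)) + dist (l ((\<sigma> k ^^ i) x)) (l ((l ^^ i) x))) \<longlonglongrightarrow> 0"
      using tendsto_add[OF 2 tendsto_dist_iff[THEN iffD1, OF 1]] by simp
  qed
  then show ?case
    by (simp add: tendsto_dist_iff[of _ "l ((l ^^ i) x)"])
qed

text \<open>By change of variables, the integral of \<open>\<phi>\<close> against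
  \<open>empirical_dist \<mu> n f\<close> is the \<open>\<mu>\<close>-integral of
  \<open>\<phi> (empirical n f x)\<close>. For fixed \<open>x\<close> this integrand is continuous
  in \<open>f\<close>, and a bound of \<open>\<phi>\<close> dominates it.\<close>

lemma empirical_dist_continuous_map:
  fixes \<mu> :: "'a::metric_space measure"
  assumes "compact (UNIV :: 'a set)" "prob_space \<mu>" "sets \<mu> = sets borel" and n: "n \<ge> 1"
  shows "continuous_map C0_topology (weak_star (weak_star euclidean)) (empirical_dist \<mu> n)"
proof -
  interpret prob_space \<mu> by fact
  let ?W = "weak_star (euclidean :: 'a topology)"
  have sp: "space \<mu> = UNIV"
    using sets_eq_imp_space_eq[OF assms(3)] by simp
  \<comment> \<open>Continuity in the starting point gives measurability, which makes
    \<open>distr\<close> a genuine push-forward.\<close>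
  have meas: "empirical n f \<in> measurable \<mu> (borel_of ?W)" if "f \<in> topspace C0_topology" for f :: "'a \<Rightarrow> 'a"
  proof -
    have f: "continuous_on UNIV f"
      using that topspace_C0_topology[OF assms(1)] by auto
    have "continuous_on UNIV (f ^^ i)" for i
      by (induction i) (auto intro!: continuous_on_compose2[OF f])
    then have "continuous_map euclidean ?W (empirical n f)"
      using continuous_map_empirical[OF n, of euclidean "\<lambda>_. f" "\<lambda>x. x"] by simp
    then show ?thesis
      by (rule continuous_map_measurable_borel_of) (simp add: assms(3) borel_of_euclidean)
  qed
  have P: "empirical_dist \<mu> n f \<in> prob_measures ?W" if "f \<in> topspace C0_topology" for f :: "'a \<Rightarrow> 'a"
    using prob_space_distr[OF meas[OF that]] by (simp add: prob_measures_def empirical_dist_def)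
  have cont: "continuous_map C0_topology euclideanreal (\<lambda>f. integral\<^sup>L (empirical_dist \<mu> n f) \<phi>)"
    if \<phi>: "continuous_map ?W euclideanreal \<phi>" "bounded (\<phi> ` topspace ?W)" for \<phi>
  proof (rule C0_topology_continuous_map_if_sequentially)
    fix \<sigma> and l :: "'a \<Rightarrow> 'a"
    assume \<sigma>: "range \<sigma> \<subseteq> topspace C0_topology" and lim: "limitin C0_topology \<sigma> l sequentially"
    have l: "l \<in> topspace C0_topology"
      by (rule limitin_topspace[OF lim])
    obtain B where B: "\<forall>M\<in>prob_measures (euclidean :: 'a topology). norm (\<phi> M) \<le> B"
      using \<phi>(2) by (auto simp: bounded_iff)
    have Bn: "norm (\<phi> (empirical n f x)) \<le> B" for f x
      by (rule bspec[OF B empirical_in_prob_measures[OF n]])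
    have \<sigma>': "\<sigma> k \<in> topspace C0_topology" for k
      using \<sigma> by blast
    have \<phi>m: "\<phi> \<in> borel_measurable (borel_of ?W)"
      using continuous_map_measurable_borel_of[OF \<phi>(1) refl] by (simp add: borel_of_euclidean)
    have m: "(\<lambda>x. \<phi> (empirical n f x)) \<in> borel_measurable \<mu>" if "f \<in> topspace C0_topology" for f
      using measurable_compose[OF meas[OF that] \<phi>m] .
    have int: "integral\<^sup>L (empirical_dist \<mu> n f) \<phi> = (\<integral>x. \<phi> (empirical n f x) \<partial>\<mu>)"
      if "f \<in> topspace C0_topology" for f
      unfolding empirical_dist_def by (rule integral_distr[OF meas[OF that] \<phi>m])
    have "(\<lambda>k. \<phi> (empirical n (\<sigma> k) x)) \<longlonglongrightarrow> \<phi> (empirical n l x)" for x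
    proof -
      have "continuous_map C0_topology euclidean (\<lambda>f::'a\<Rightarrow>'a. (f ^^ i) x)" for i
        by (rule C0_topology_continuous_map_if_sequentially) (rule C0_limit_funpow)
      then have "continuous_map C0_topology ?W (\<lambda>f. empirical n f x)"
        by (rule continuous_map_empirical[OF n])
      then have "continuous_map C0_topology euclideanreal (\<phi> \<circ> (\<lambda>f. empirical n f x))"
        using \<phi>(1) by (rule continuous_map_compose)
      from continuous_map_limit[OF this lim] show ?thesis
        by (simp add: o_def)
    qed
    then have "(\<lambda>k. \<integral>x. \<phi> (empirical n (\<sigma> k) x) \<partial>\<mu>) \<longlonglongrightarrow> (\<integral>x. \<phi> (empirical n l x) \<partial>\<mu>)"
      by (intro integral_dominated_convergence[where w = "\<lambda>_. B"] m l \<sigma>' AE_I2 Bn) auto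
    then show "(\<lambda>k. integral\<^sup>L (empirical_dist \<mu> n (\<sigma> k)) \<phi>) \<longlonglongrightarrow> integral\<^sup>L (empirical_dist \<mu> n l) \<phi>"
      unfolding int[OF \<sigma>'] int[OF l] .
  qed
  show ?thesis
    unfolding weak_star_def[of ?W]
  proof (rule continuous_on_generated_topo)
    show "empirical_dist \<mu> n ` topspace C0_topology \<subseteq> \<Union> {{M \<in> prob_measures ?W. integral\<^sup>L M \<phi> \<in> U} | \<phi> U.
        continuous_map ?W euclideanreal \<phi> \<and> bounded (\<phi> ` topspace ?W) \<and> open U}"
      using P topspace_weak_star[of ?W, unfolded weak_star_def[of ?W] topology_generated_by_topspace]
      by blast
    fix V assume "V \<in> {{M \<in> prob_measures ?W. integral\<^sup>L M \<phi> \<in> U} | \<phi> U.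
        continuous_map ?W euclideanreal \<phi> \<and> bounded (\<phi> ` topspace ?W) \<and> open U}"
    then obtain \<phi> U where V: "V = {M \<in> prob_measures ?W. integral\<^sup>L M \<phi> \<in> U}"
      and \<phi>: "continuous_map ?W euclideanreal \<phi>" "bounded (\<phi> ` topspace ?W)" and "open U"
      by blast
    have "openin C0_topology {f \<in> topspace C0_topology. integral\<^sup>L (empirical_dist \<mu> n f) \<phi> \<in> U}"
      by (rule openin_continuous_map_preimage[OF cont[OF \<phi>]]) (use \<open>open U\<close> in auto)
    moreover have "empirical_dist \<mu> n -` V \<inter> topspace C0_topology =
        {f \<in> topspace C0_topology. integral\<^sup>L (empirical_dist \<mu> n f) \<phi> \<in> U}"
      using P by (auto simp: V)
    ultimately show "openin C0_topology (empirical_dist \<mu> n -` V \<inter> topspace C0_topology)"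
      by simp
  qed
qed

section \<open>Genericity\<close>

text \<open>Choose increasing times along a decreasing countable neighbourhood base of
  \<open>l\<close>.\<close>

lemma limitin_subseq_if_frequently:
  fixes s :: "nat \<Rightarrow> 'a"
  assumes "first_countable T" "l \<in> topspace T"
    and freq: "\<And>U N. openin T U \<Longrightarrow> l \<in> U \<Longrightarrow> \<exists>n\<ge>N. s n \<in> U"
  shows "\<exists>r :: nat \<Rightarrow> nat. strict_mono r \<and> limitin T (s \<circ> r) l sequentially"
proof -
  obtain B where B: "countable B" "\<And>V. V \<in> B \<Longrightarrow> openin T V"
      "\<And>U. openin T U \<Longrightarrow> l \<in> U \<Longrightarrow> \<exists>V\<in>B. l \<in> V \<and> V \<subseteq> U"
    using assms(1,2) unfolding first_countable_def by (metis (lifting))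
  define C where "C = {V \<in> B. l \<in> V}"
  have C: "countable C" "C \<noteq> {}"
    using B(1) B(3)[OF openin_topspace assms(2)] by (auto simp: C_def)
  define V where "V = from_nat_into C"
  have V: "openin T (V i)" "l \<in> V i" for i
    using from_nat_into[OF C(2), of i] B(2) by (auto simp: V_def C_def)
  \<comment> \<open>Finite intersections make the base nested, so once \<open>k\<close> reaches
    \<open>i\<close>, all later terms stay in \<open>V i\<close>.\<close>
  define W where "W k = (\<Inter>i\<in>{..k}. V i)" for k
  have W: "openin T (W k)" "l \<in> W k" for k
    unfolding W_def using V by (auto intro!: openin_Inter)
  have base: "\<exists>n. s n \<in> W 0"
    using freq[OF W, of 0 0] by blast
  have step: "\<exists>n. s n \<in> W (Suc k) \<and> m < n" for m k
    using freq[OF W, of "Suc m" "Suc k"] by (auto simp: Suc_le_eq)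
  have "\<exists>r. \<forall>k. s (r k) \<in> W k \<and> r k < r (Suc k)"
    by (rule dependent_nat_choice[OF base step])
  then obtain r where r: "\<And>k. s (r k) \<in> W k" "strict_mono r"
    by (auto simp: strict_mono_Suc_iff)
  have "limitin T (s \<circ> r) l sequentially"
    unfolding limitin_sequentially
  proof (intro conjI allI impI)
    fix U assume U: "openin T U \<and> l \<in> U"
    then obtain V' where V': "V' \<in> C" "V' \<subseteq> U"
      using B(3)[of U] by (auto simp: C_def)
    obtain i where "V i = V'"
      unfolding V_def using from_nat_into_surj[OF C(1) V'(1)] by blast
    then have "W k \<subseteq> U" if "k \<ge> i" for k
      using that V'(2) by (auto simp: W_def)
    then have "\<forall>k\<ge>i. (s \<circ> r) k \<in> U"
      using r(1) by (auto simp: subset_iff)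
    then show "\<exists>N. \<forall>k. N \<le> k \<longrightarrow> (s \<circ> r) k \<in> U" ..
  qed (rule assms(2))
  with r(2) show ?thesis by blast
qed

text \<open>Every point lies in the closure of \<open>U\<close> or in its exterior, and both are
  inside the closure of the union.\<close>

lemma dense_openin_Un_exterior:
  assumes "openin T U"
  shows "dense_openin T (U \<union> (topspace T - T closure_of U))"
proof -
  let ?W = "U \<union> (topspace T - T closure_of U)"
  have "T closure_of U \<subseteq> T closure_of ?W"
    by (intro closure_of_mono) auto
  moreover have "?W \<subseteq> T closure_of ?W"
    using openin_subset[OF assms] by (intro closure_of_subset) auto
  ultimately have "T closure_of ?W = topspace T"
    using closure_of_subset_topspace[of T ?W] by blast
  moreover have "openin T ?W"
    using assms by (intro openin_Un openin_diff) auto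
  ultimately show ?thesis
    by (simp add: dense_openin_def)
qed


theorem theorem1p14:
  fixes \<mu> :: "'a::metric_space measure"
    and L :: "('a \<Rightarrow> 'a) topology"
  assumes "compact (UNIV :: 'a set)"
    and "prob_space \<mu>" and "sets \<mu> = sets borel"
    and "topspace L \<subseteq> {f. continuous_on UNIV f}"
    and "finer_than_C0 L"
    and "baire_space L"
  shows "baire_generic L (\<lambda>f. bifurcation_set L \<mu> f =
           accumulation_points (weak_star (weak_star euclidean)) (\<lambda>n. empirical_dist \<mu> n f))"
proof -
  let ?Y = "weak_star (weak_star (euclidean :: 'a topology))"
  let ?e = "empirical_dist \<mu>"
  have top: "topspace L \<subseteq> topspace C0_topology"
    using assms(4) topspace_C0_topology[OF assms(1)] by simp
  have cont: "continuous_map L ?Y (?e n)" if "n \<ge> 1" for n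
  proof -
    have C0: "continuous_map C0_topology ?Y (?e n)"
      by (rule empirical_dist_continuous_map[OF assms(1-3) that])
    \<comment> \<open>A finer topology makes the inclusion of \<open>L\<close> continuous, so
      continuity passes from \<open>C0_topology\<close> to \<open>L\<close>.\<close>
    have "openin L {f \<in> topspace L. f \<in> U}" if "openin C0_topology U" for U
    proof -
      have "openin L (topspace L \<inter> U)"
        using assms(5) openin_subtopology_Int2[OF that, of "topspace L"] unfolding finer_than_C0_def by blast
      then show ?thesis
        by (simp add: Int_def)
    qed
    then have "continuous_map L C0_topology (\<lambda>f. f)"
      using top by (auto simp: continuous_map_def)
    from continuous_map_compose[OF this C0] show ?thesis
      by (simp add: o_def)
  qed
  have sc: "second_countable ?Y"
    by (rule second_countable_weak_star_weak_star[OF assms(1)])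
  then obtain \<B> where \<B>: "countable \<B>" "\<And>V. V \<in> \<B> \<Longrightarrow> openin ?Y V"
      "\<And>U x. openin ?Y U \<Longrightarrow> x \<in> U \<Longrightarrow> \<exists>V\<in>\<B>. x \<in> V \<and> V \<subseteq> U"
    unfolding second_countable_def by (metis (lifting))
  define A where "A V N = {f \<in> topspace L. \<exists>n\<ge>Suc N. ?e n f \<in> V}" for V N
  define W where "W V N = A V N \<union> (topspace L - L closure_of A V N)" for V N
  have A: "openin L (A V N)" if "V \<in> \<B>" for V N
  proof -
    have "A V N = (\<Union>n\<in>{Suc N..}. {f \<in> topspace L. ?e n f \<in> V})"
      by (auto simp: A_def)
    moreover have "openin L {f \<in> topspace L. ?e n f \<in> V}" if "n \<ge> Suc N" for n
      using that by (intro openin_continuous_map_preimage[OF cont \<B>(2)[OF \<open>V \<in> \<B>\<close>]]) auto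
    ultimately show ?thesis
      by (auto intro!: openin_Union)
  qed
  let ?G = "case_prod W ` (\<B> \<times> UNIV)"
  have "countable ?G"
    using \<B>(1) by (intro countable_image countable_SIGMA) auto
  moreover have "dense_openin L U" if "U \<in> ?G" for U
    using that dense_openin_Un_exterior[OF A] by (auto simp: W_def)
  moreover have "bifurcation_set L \<mu> f = accumulation_points ?Y (\<lambda>n. ?e n f)"
    if f: "f \<in> topspace L \<inter> \<Inter> ?G" for f
  proof (intro equalityI subsetI)
    fix \<nu> assume "\<nu> \<in> bifurcation_set L \<mu> f"
    then obtain g n where g: "\<And>k. g k \<in> topspace L" "limitin L g f sequentially"
      and n: "filterlim n at_top sequentially"
      and lim: "limitin ?Y (\<lambda>k. ?e (n k) (g k)) \<nu> sequentially"
      unfolding bifurcation_set_def by blast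
    have "\<exists>m\<ge>N. ?e m f \<in> U" if U: "openin ?Y U" "\<nu> \<in> U" for U N
    proof -
      obtain V where V: "V \<in> \<B>" "\<nu> \<in> V" "V \<subseteq> U"
        using \<B>(3)[OF U] by blast
      \<comment> \<open>The times \<open>n k\<close> eventually exceed \<open>N\<close>, so
        \<open>n k\<close> itself witnesses that the perturbation \<open>g k\<close> belongs to
        \<open>A V N\<close>.\<close>
      have ev: "\<forall>\<^sub>F k in sequentially. g k \<in> A V N"
      proof -
        have "\<forall>\<^sub>F k in sequentially. ?e (n k) (g k) \<in> V"
          using lim \<B>(2)[OF V(1)] V(2) unfolding limitin_def by blast
        moreover have "\<forall>\<^sub>F k in sequentially. Suc N \<le> n k"
          using n unfolding filterlim_at_top by blast
        ultimately show ?thesis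
          by eventually_elim (use g(1) in \<open>auto simp: A_def\<close>)
      qed
      have "f \<in> L closure_of A V N"
        unfolding in_closure_of
      proof (intro conjI allI impI)
        fix T assume "f \<in> T \<and> openin L T"
        then have "\<forall>\<^sub>F k in sequentially. g k \<in> T"
          using g(2) unfolding limitin_def by blast
        from eventually_conj[OF this ev] show "\<exists>y. y \<in> A V N \<and> y \<in> T"
          using eventually_happens'[OF sequentially_bot] by blast
      qed (use f in blast)
      \<comment> \<open>A point of the closure is not in the exterior, so membership in
        \<open>W V N\<close> forces \<open>f\<close> into \<open>A V N\<close>, giving a time of
        \<open>f\<close> itself.\<close>
      moreover have "f \<in> W V N"
        using f V(1) by auto
      ultimately have "f \<in> A V N"
        by (simp add: W_def)
      then show ?thesis
        using V(3) Suc_leD unfolding A_def by blast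
    qed
    then show "\<nu> \<in> accumulation_points ?Y (\<lambda>n. ?e n f)"
      using limitin_subseq_if_frequently[OF second_countable_imp_first_countable[OF sc], of \<nu> "\<lambda>n. ?e n f"]
        limitin_topspace[OF lim]
      unfolding accumulation_points_def by blast
  next
    fix \<nu> assume "\<nu> \<in> accumulation_points ?Y (\<lambda>n. ?e n f)"
    then obtain r :: "nat \<Rightarrow> nat" where r: "strict_mono r" "limitin ?Y ((\<lambda>n. ?e n f) \<circ> r) \<nu> sequentially"
      unfolding accumulation_points_def by blast
    \<comment> \<open>The constant sequence \<open>f\<close> serves as the perturbation, and a
      strictly increasing \<open>r\<close> tends to infinity.\<close>
    then show "\<nu> \<in> bifurcation_set L \<mu> f"
      unfolding bifurcation_set_def
      using f filterlim_subseq[OF r(1)]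
      by (intro CollectI exI[of _ "\<lambda>_. f"] exI[of _ r]) (auto simp: o_def)
  qed
  ultimately show ?thesis
    unfolding baire_generic_def by (intro exI[of _ ?G]) blast
qed

end
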